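(* Let $r \geq 3$ and $n \geq 0$ be integers. There exists a twin-free $K_r$-saturated graph on $n$ vertices if and only if none of the following holds: $n=r$; $n=r+1$; $r=3$ and $n=6$; $r=3$ and $n=7$.
   Context: All graphs are finite and simple. For a vertex $v$, $\Gamma(v)$ denotes its (open) neighbourhood. Two distinct vertices $v,w$ are twins if $\Gamma(v)=\Gamma(w)$; a graph is twin-free if it has no pair of twins. A graph $G$ is $K_r$-saturated if $G$ contains no copy of $K_r$ but adding any edge between two non-adjacent vertices of $G$ creates a copy of $K_r$. *)

theory Defs
  imports Main
begin

definition simple_graph :: "'a set \<Rightarrow> 'a set set \<Rightarrow> bool" where
  "simple_graph V E \<longleftrightarrow> finite V \<and> (\<forall>e\<in>E. e \<subseteq> V \<and> card e = 2)"

definition neighbourhood :: "'a set \<Rightarrow> 'a set set \<Rightarrow> 'a \<Rightarrow> 'a set" where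
  "neighbourhood V E v = {w \<in> V. {v, w} \<in> E}"

definition twins :: "'a set \<Rightarrow> 'a set set \<Rightarrow> 'a \<Rightarrow> 'a \<Rightarrow> bool" where
  "twins V E v w \<longleftrightarrow> v \<in> V \<and> w \<in> V \<and> v \<noteq> w \<and> neighbourhood V E v = neighbourhood V E w"

definition twin_free :: "'a set \<Rightarrow> 'a set set \<Rightarrow> bool" where
  "twin_free V E \<longleftrightarrow> \<not> (\<exists>v w. twins V E v w)"

definition contains_complete :: "nat \<Rightarrow> 'a set \<Rightarrow> 'a set set \<Rightarrow> bool" where
  "contains_complete r V E \<longleftrightarrow>
     (\<exists>S. S \<subseteq> V \<and> finite S \<and> card S = r \<and> (\<forall>v\<in>S. \<forall>w\<in>S. v \<noteq> w \<longrightarrow> {v, w} \<in> E))"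

definition complete_saturated :: "nat \<Rightarrow> 'a set \<Rightarrow> 'a set set \<Rightarrow> bool" where
  "complete_saturated r V E \<longleftrightarrow>
     \<not> contains_complete r V E \<and>
     (\<forall>v\<in>V. \<forall>w\<in>V. v \<noteq> w \<and> {v, w} \<notin> E \<longrightarrow> contains_complete r V (insert {v, w} E))"

end

theory Submission imports Defs begin

text \<open>
  For \<open>n < r\<close> take a complete graph. If \<open>n = r\<close>, a saturated graph is complete minus an edge, whose ends
  are twins; if \<open>n = r + 1\<close>, distinguishing the two ends of a non-edge forces the non-edges to form a
  path of length two, and then removing its middle vertex leaves a \<open>K\<^sub>r\<close>. A twin-free maximal
  triangle-free graph on at least three vertices contains a pentagon, and a case analysis shows
  that one or two further vertices always create twins, which excludes \<open>r = 3\<close>, \<open>n = 6, 7\<close>.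

  Conversely, adding a dominating vertex turns a solution for \<open>(r, n)\<close> into one for
  \<open>(r + 1, n + 1)\<close>. For \<open>r = 3\<close> a three-vertex extension that can be iterated reaches every
  \<open>n = 5\<close>, \<open>n \<ge> 8\<close> from graphs on 5, 9 and 10 vertices. Together with two \<open>K\<^sub>4\<close>-saturated graphs
  on 7 and 8 vertices this gives all \<open>n \<ge> r + 2\<close> for \<open>r \<ge> 4\<close>.
\<close>

subsection \<open>Cliques and saturation\<close>

definition clique :: "'a set set \<Rightarrow> 'a set \<Rightarrow> bool" where
  "clique E S \<longleftrightarrow> (\<forall>v\<in>S. \<forall>w\<in>S. v \<noteq> w \<longrightarrow> {v, w} \<in> E)"

lemma clique_mono: "clique E S \<Longrightarrow> T \<subseteq> S \<Longrightarrow> E \<subseteq> F \<Longrightarrow> clique F T"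
  unfolding clique_def by blast

lemma cliqueD: "clique E S \<Longrightarrow> v \<in> S \<Longrightarrow> w \<in> S \<Longrightarrow> v \<noteq> w \<Longrightarrow> {v, w} \<in> E"
  unfolding clique_def by blast

lemma contains_complete_iff:
  "finite V \<Longrightarrow> contains_complete r V E \<longleftrightarrow> (\<exists>S\<subseteq>V. card S = r \<and> clique E S)"
  unfolding contains_complete_def clique_def by (metis finite_subset)

lemma simple_graph_edge:
  assumes "simple_graph V E" "{v, w} \<in> E"
  shows "v \<in> V" "w \<in> V" "v \<noteq> w"
  using assms unfolding simple_graph_def by (auto simp: card_insert_if split: if_splits)

text \<open>A copy of \<open>K_r\<close> created by the edge \<open>{v, w}\<close> must use it;
  removing both ends leaves a \<open>k\<close>-clique in their common neighbourhood. Writing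
  \<open>r = k + 2\<close> avoids subtraction.\<close>

lemma complete_saturated_iff:
  assumes G: "simple_graph V E"
  shows "complete_saturated (k + 2) V E \<longleftrightarrow>
    (\<forall>S\<subseteq>V. card S = k + 2 \<longrightarrow> \<not> clique E S) \<and>
    (\<forall>v\<in>V. \<forall>w\<in>V. v \<noteq> w \<and> {v, w} \<notin> E \<longrightarrow>
      (\<exists>T\<subseteq>V - {v, w}. card T = k \<and> clique E (insert v T) \<and> clique E (insert w T)))"
    (is "_ \<longleftrightarrow> ?free \<and> ?ext")
proof -
  have fin: "finite V" using G by (simp add: simple_graph_def)
  have ext_iff: "contains_complete (k + 2) V (insert {v, w} E) \<longleftrightarrow>
      (\<exists>T\<subseteq>V - {v, w}. card T = k \<and> clique E (insert v T) \<and> clique E (insert w T))"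
    if free: ?free and vw: "v \<in> V" "w \<in> V" "v \<noteq> w" for v w
  proof
    assume "contains_complete (k + 2) V (insert {v, w} E)"
    then obtain S where S: "S \<subseteq> V" "card S = k + 2" "clique (insert {v, w} E) S"
      using contains_complete_iff[OF fin] by blast
    have finS: "finite S" using S(1) fin by (rule finite_subset)
    have "\<not> clique E S" using free S by blast
    then obtain x y where "x \<in> S" "y \<in> S" "x \<noteq> y" "{x, y} \<notin> E"
      unfolding clique_def by blast
    then have "{x, y} = {v, w}" using S(3) unfolding clique_def by blast
    then have mem: "v \<in> S" "w \<in> S" using \<open>x \<in> S\<close> \<open>y \<in> S\<close> by (auto simp: doubleton_eq_iff)
    let ?T = "S - {v, w}"
    have "card ?T = k" using S(2) mem vw(3) finS by (simp add: card_Diff_subset)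
    moreover have "clique E (insert v ?T)" "clique E (insert w ?T)"
      using S(3) mem unfolding clique_def by (auto simp: doubleton_eq_iff)
    ultimately show "\<exists>T\<subseteq>V - {v, w}. card T = k \<and> clique E (insert v T) \<and> clique E (insert w T)"
      using S(1) by (intro exI[of _ ?T]) auto
  next
    assume "\<exists>T\<subseteq>V - {v, w}. card T = k \<and> clique E (insert v T) \<and> clique E (insert w T)"
    then obtain T where T: "T \<subseteq> V - {v, w}" "card T = k" "clique E (insert v T)" "clique E (insert w T)"
      by blast
    have finT: "finite T" using T(1) fin by (meson finite_Diff finite_subset)
    have "v \<notin> T" "w \<notin> T" using T(1) by auto
    then have "card (insert v (insert w T)) = k + 2" using T(2) vw(3) finT by simp
    moreover have "clique (insert {v, w} E) (insert v (insert w T))"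
      using T(3,4) unfolding clique_def by (auto simp: insert_commute)
    moreover have "insert v (insert w T) \<subseteq> V" using T(1) vw by auto
    ultimately show "contains_complete (k + 2) V (insert {v, w} E)"
      using contains_complete_iff[OF fin] by blast
  qed
  have free_iff: "\<not> contains_complete (k + 2) V E \<longleftrightarrow> ?free"
    using contains_complete_iff[OF fin] by blast
  show ?thesis
    unfolding complete_saturated_def free_iff
    by (intro conj_cong refl ball_cong imp_cong ext_iff) blast+
qed

lemma twin_free_iff:
  assumes "simple_graph V E"
  shows "twin_free V E \<longleftrightarrow>
    (\<forall>v\<in>V. \<forall>w\<in>V. v \<noteq> w \<longrightarrow> (\<exists>x. ({v, x} \<in> E) \<noteq> ({w, x} \<in> E)))"
proof -
  have "neighbourhood V E v = neighbourhood V E w \<longleftrightarrow> (\<forall>x. ({v, x} \<in> E) = ({w, x} \<in> E))" for v w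
    using simple_graph_edge(2)[OF assms] unfolding neighbourhood_def by auto
  then show ?thesis unfolding twin_free_def twins_def by auto
qed

text \<open>Possibly only one end of the non-edge has a neighbour that the other lacks, so the pair
  may come back swapped.\<close>

lemma twin_free_distinguish:
  assumes "simple_graph V E" "twin_free V E" "v \<in> V" "w \<in> V" "v \<noteq> w" "{v, w} \<notin> E"
  obtains u u' x where "u \<in> V" "u' \<in> V" "u \<noteq> u'" "{u, u'} \<notin> E" "{u, x} \<in> E" "{u', x} \<notin> E"
proof -
  obtain x where "({v, x} \<in> E) \<noteq> ({w, x} \<in> E)"
    using assms unfolding twin_free_iff[OF assms(1)] by blast
  then show thesis using that[of v w x] that[of w v x] assms(3-)
    by (cases "{v, x} \<in> E") (auto simp: insert_commute)
qed

lemma saturated_3_iff: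
  assumes G: "simple_graph V E"
  shows "complete_saturated 3 V E \<longleftrightarrow>
    (\<forall>a b c. {a, b} \<in> E \<and> {b, c} \<in> E \<longrightarrow> {a, c} \<notin> E) \<and>
    (\<forall>v\<in>V. \<forall>w\<in>V. v \<noteq> w \<and> {v, w} \<notin> E \<longrightarrow> (\<exists>x. {v, x} \<in> E \<and> {w, x} \<in> E))"
proof -
  have three: "(1::nat) + 2 = 3" by simp
  have tri: "(\<forall>S\<subseteq>V. card S = 3 \<longrightarrow> \<not> clique E S) \<longleftrightarrow>
      (\<forall>a b c. {a, b} \<in> E \<and> {b, c} \<in> E \<longrightarrow> {a, c} \<notin> E)" (is "?L \<longleftrightarrow> ?R")
  proof
    assume L: ?L
    show ?R
    proof (intro allI impI notI)
      fix a b c assume *: "{a, b} \<in> E \<and> {b, c} \<in> E" "{a, c} \<in> E"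
      then have "a \<noteq> b" "b \<noteq> c" "a \<noteq> c" "{a, b, c} \<subseteq> V"
        using simple_graph_edge[OF G] by blast+
      then show False using L * unfolding clique_def
        by (auto dest!: spec[of _ "{a, b, c}"] simp: insert_commute)
    qed
  next
    assume ?R
    then show ?L unfolding clique_def card_3_iff by blast
  qed
  have nb: "(\<exists>T\<subseteq>V - {v, w}. card T = 1 \<and> clique E (insert v T) \<and> clique E (insert w T)) \<longleftrightarrow>
      (\<exists>x. {v, x} \<in> E \<and> {w, x} \<in> E)" if "v \<noteq> w" for v w
  proof
    assume "\<exists>T\<subseteq>V - {v, w}. card T = 1 \<and> clique E (insert v T) \<and> clique E (insert w T)"
    then show "\<exists>x. {v, x} \<in> E \<and> {w, x} \<in> E" unfolding clique_def
      by (metis card_1_singletonE DiffE insertCI subset_iff)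
  next
    assume "\<exists>x. {v, x} \<in> E \<and> {w, x} \<in> E"
    then obtain x where x: "{v, x} \<in> E" "{w, x} \<in> E" by blast
    then have "x \<in> V - {v, w}" using simple_graph_edge[OF G] by blast
    then show "\<exists>T\<subseteq>V - {v, w}. card T = 1 \<and> clique E (insert v T) \<and> clique E (insert w T)"
      using x by (intro exI[of _ "{x}"]) (auto simp: clique_def insert_commute)
  qed
  show ?thesis
    unfolding complete_saturated_iff[OF G, of 1, unfolded three] tri
    by (intro conj_cong refl ball_cong imp_cong nb) blast
qed

lemma complete_graph_saturated:
  assumes "finite V" "card V < r"
  defines "E \<equiv> {e. e \<subseteq> V \<and> card e = 2}"
  shows "simple_graph V E" "twin_free V E" "complete_saturated r V E"
proof -
  show G: "simple_graph V E" using assms by (simp add: simple_graph_def)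
  have E: "{v, w} \<in> E \<longleftrightarrow> v \<in> V \<and> w \<in> V \<and> v \<noteq> w" for v w
    unfolding E_def by (auto simp: card_insert_if)
  show "twin_free V E" unfolding twin_free_iff[OF G] E by blast
  have "\<not> contains_complete r V E"
    unfolding contains_complete_iff[OF assms(1)] using assms(2) card_mono[OF assms(1)] by (metis leD)
  then show "complete_saturated r V E" unfolding complete_saturated_def E by blast
qed


subsection \<open>Impossible orders\<close>

lemma no_twin_free_saturated_r:
  assumes G: "simple_graph V E" and "twin_free V E" and "complete_saturated (k + 2) V E"
  shows "card V \<noteq> k + 2"
proof
  assume card: "card V = k + 2"
  have fin: "finite V" using G by (simp add: simple_graph_def)
  note sat = assms(3)[unfolded complete_saturated_iff[OF G]]
  have "\<not> clique E V" using sat card by blast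
  then obtain v w where vw: "v \<in> V" "w \<in> V" "v \<noteq> w" "{v, w} \<notin> E" unfolding clique_def by blast
  then obtain T where T: "T \<subseteq> V - {v, w}" "card T = k" "clique E (insert v T)" "clique E (insert w T)"
    using sat by blast
  have "card (V - {v, w}) = k" using vw card fin by (simp add: card_Diff_subset)
  then have "T = V - {v, w}" using T fin by (simp add: card_subset_eq)
  then have "({v, x} \<in> E) = ({w, x} \<in> E)" for x
  proof (cases "x \<in> T")
    case True
    then show ?thesis using T(1) cliqueD[OF T(3), of v x] cliqueD[OF T(4), of w x] by auto
  next
    case False
    then have "x = v \<or> x = w \<or> x \<notin> V" using \<open>T = V - {v, w}\<close> by auto
    then show ?thesis
      using vw(4) simple_graph_edge[OF G, of v x] simple_graph_edge[OF G, of w x] by (auto simp: insert_commute)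
  qed
  then show False using assms(2) vw unfolding twin_free_iff[OF G] by blast
qed

text \<open>A non-edge \<open>{v, w}\<close> leaves \<open>k + 1\<close> other vertices, of which
  its clique \<open>T\<close> omits exactly one. Distinguishing the ends identifies the omitted
  vertices until all non-edges are seen to share one vertex.\<close>

lemma no_twin_free_saturated_Suc_r:
  assumes G: "simple_graph V E" and "twin_free V E" and "complete_saturated (k + 2) V E"
  shows "card V \<noteq> k + 3"
proof
  assume card: "card V = k + 3"
  have fin: "finite V" using G by (simp add: simple_graph_def)
  note sat = assms(3)[unfolded complete_saturated_iff[OF G]]
  have omit: "\<exists>t\<in>V - {v, w}. clique E (V - {v, t}) \<and> clique E (V - {w, t})"
    if vw: "v \<in> V" "w \<in> V" "v \<noteq> w" "{v, w} \<notin> E" for v w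
  proof -
    obtain T where T: "T \<subseteq> V - {v, w}" "card T = k" "clique E (insert v T)" "clique E (insert w T)"
      using sat vw by blast
    have "card (V - {v, w}) = k + 1" using vw card fin by (simp add: card_Diff_subset)
    then have "card (V - {v, w} - T) = 1" using T fin by (simp add: card_Diff_subset finite_subset)
    then obtain t where "V - {v, w} - T = {t}" by (rule card_1_singletonE)
    then have eq: "V - {v, t} = insert w T" "V - {w, t} = insert v T" and t: "t \<in> V - {v, w}"
      using T(1) vw by blast+
    show ?thesis using t T(3,4) by (intro bexI[of _ t]) (simp_all only: eq simp_thms)
  qed
  have cliques: "\<not> clique E S" if "S \<subseteq> V" "card S = k + 2" for S using sat that by blast
  obtain S where "S \<subseteq> V" "card S = k + 2"
    using card obtain_subset_with_card_n[of "k + 2" V] by auto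
  then have "\<not> clique E V" using cliques clique_mono[OF _ _ order_refl] by metis
  then obtain v w where vw: "v \<in> V" "w \<in> V" "v \<noteq> w" "{v, w} \<notin> E" unfolding clique_def by blast
  obtain u w x where uw: "u \<in> V" "w \<in> V" "u \<noteq> w" "{u, w} \<notin> E" "{u, x} \<in> E" "{w, x} \<notin> E"
    by (rule twin_free_distinguish[OF assms(1,2) vw])
  obtain t where t: "t \<in> V - {u, w}" "clique E (V - {u, t})" "clique E (V - {w, t})"
    using omit uw by blast
  have x: "x \<in> V" "x \<noteq> u" "x \<noteq> w" using uw simple_graph_edge[OF G, of u x] by auto
  \<comment> \<open>\<open>V - {u, t}\<close> is a clique containing \<open>w\<close>; as
    \<open>{w, x}\<close> is no edge, \<open>x\<close> must be the omitted vertex.\<close>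
  have "x = t"
  proof (rule ccontr)
    assume "x \<noteq> t"
    then have "x \<in> V - {u, t}" "w \<in> V - {u, t}" using x uw t(1) by auto
    then show False using cliqueD[OF t(2), of w x] x(3) uw(6) by simp
  qed
  then have "{w, t} \<notin> E" "{u, t} \<in> E" using uw by auto
  \<comment> \<open>\<open>{w, t}\<close> is a second non-edge, so \<open>omit\<close> applies to it
    as well.\<close>
  then obtain t' where t': "t' \<in> V - {w, t}" "clique E (V - {w, t'})" "clique E (V - {t, t'})"
    using omit[of w t] t(1) uw(2) by auto
  \<comment> \<open>Otherwise the non-edge \<open>{u, w}\<close> would lie inside the clique
    \<open>V - {t, t'}\<close>.\<close>
  have "t' = u"
  proof (rule ccontr)
    assume "t' \<noteq> u"
    then have "u \<in> V - {t, t'}" "w \<in> V - {t, t'}" using uw t(1) t'(1) by auto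
    then show False using cliqueD[OF t'(3)] uw(3,4) by metis
  qed
  \<comment> \<open>Away from \<open>w\<close>, only the pair \<open>{u, t}\<close> lies in neither
    of the cliques \<open>V - {w, t}\<close> and \<open>V - {w, u}\<close>, and it is an
    edge.\<close>
  have "{p, q} \<in> E" if pq: "p \<in> V - {w}" "q \<in> V - {w}" "p \<noteq> q" for p q
  proof (cases "t \<in> {p, q} \<and> u \<in> {p, q}")
    case True
    then have "{p, q} = {u, t}" using t(1) by auto
    then show ?thesis using \<open>{u, t} \<in> E\<close> by simp
  next
    case False
    then consider "p \<in> V - {w, t}" "q \<in> V - {w, t}" | "p \<in> V - {w, t'}" "q \<in> V - {w, t'}"
      using pq \<open>t' = u\<close> by blast
    then show ?thesis using cliqueD[OF t(3)] cliqueD[OF t'(2)] pq(3) by cases metis+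
  qed
  then have "clique E (V - {w})" unfolding clique_def by simp
  moreover have "card (V - {w}) = k + 2" using card uw fin by simp
  ultimately show False using cliques[of "V - {w}"] by auto
qed

text \<open>Take a non-edge \<open>{u, w}\<close> and \<open>p\<close> adjacent to \<open>u\<close>
  but not to \<open>w\<close>. Let \<open>s\<close> be a common neighbour of \<open>u\<close>,
  \<open>w\<close> and \<open>q\<close> one of \<open>w\<close>, \<open>p\<close>. If
  \<open>q = s\<close>, then \<open>u\<close>, \<open>p\<close>, \<open>s\<close> form a triangle;
  otherwise \<open>u p q w s\<close> is a pentagon.\<close>

lemma pentagon_exists:
  assumes G: "simple_graph V E" and "twin_free V E" and "complete_saturated 3 V E" and "card V \<ge> 3"
  obtains a b c d e where "{a, b} \<in> E" "{b, c} \<in> E" "{c, d} \<in> E" "{d, e} \<in> E" "{e, a} \<in> E"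
    "distinct [a, b, c, d, e]"
proof -
  have tri: "{a, b} \<in> E \<Longrightarrow> {b, c} \<in> E \<Longrightarrow> {a, c} \<notin> E" for a b c
    using assms(3) unfolding saturated_3_iff[OF G] by blast
  have com: "\<exists>x. {v, x} \<in> E \<and> {w, x} \<in> E" if "v \<in> V" "w \<in> V" "v \<noteq> w" "{v, w} \<notin> E" for v w
    using assms(3) that unfolding saturated_3_iff[OF G] by blast
  obtain S where "S \<subseteq> V" "card S = 3" using assms(4) by (meson obtain_subset_with_card_n)
  then obtain v w where vw: "v \<in> V" "w \<in> V" "v \<noteq> w" "{v, w} \<notin> E"
    using tri unfolding card_3_iff by (metis insert_subset)
  obtain u w p where uw: "u \<in> V" "w \<in> V" "u \<noteq> w" "{u, w} \<notin> E" "{u, p} \<in> E" "{w, p} \<notin> E"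
    by (rule twin_free_distinguish[OF assms(1,2) vw])
  obtain s where s: "{u, s} \<in> E" "{w, s} \<in> E" using com uw by blast
  have p: "p \<in> V" "p \<noteq> w" using simple_graph_edge[OF G uw(5)] uw by (auto simp: insert_commute)
  then obtain q where q: "{w, q} \<in> E" "{p, q} \<in> E" using com[of w p] uw by blast
  have "q \<noteq> s" using tri[of u p q] uw(5) q s by auto
  then have "distinct [u, p, q, w, s]"
    using uw p q s simple_graph_edge[OF G] by (auto simp: insert_commute)
  then show thesis using that[of u p q w s] uw q s by (simp add: insert_commute)
qed

text \<open>The conditions on the one or two vertices outside a pentagon involve finitely many
  adjacencies. Stated for one pentagon vertex and then rotated, they are propositionally
  contradictory.\<close>

lemma no_twin_free_saturated_3:
  assumes G: "simple_graph V E" and "twin_free V E" and "complete_saturated 3 V E"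
  shows "card V \<noteq> 6" and "card V \<noteq> 7"
proof -
  define R where "R = (\<lambda>u v. {u, v} \<in> E)"
  have fin: "finite V" using G by (simp add: simple_graph_def)
  have R: "R u v \<longleftrightarrow> R v u" "\<not> R u u" "R u v \<Longrightarrow> u \<in> V" "R u v \<Longrightarrow> v \<in> V" for u v
    using simple_graph_edge[OF G, of u v] simple_graph_edge(3)[OF G, of u u] unfolding R_def
    by (auto simp: insert_commute)
  have tri: "R a b \<and> R b c \<Longrightarrow> \<not> R a c" for a b c
    using assms(3) unfolding saturated_3_iff[OF G] R_def by blast
  have com: "v = w \<or> R v w \<or> (\<exists>x\<in>V. R v x \<and> R w x)" if "v \<in> V" "w \<in> V" for v w
    using assms(3) that R(4) unfolding saturated_3_iff[OF G] R_def by blast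
  have twin: "v = w \<or> (\<exists>x\<in>V. R v x \<noteq> R w x)" if "v \<in> V" "w \<in> V" for v w
    using assms(2) that R(4) unfolding twin_free_iff[OF G] R_def by blast
  \<comment> \<open>In order: no triangle \<open>x a b\<close>; \<open>x\<close> and
    \<open>a\<close> are adjacent or share one of \<open>b\<close>, \<open>e\<close>,
    \<open>y\<close>; no triangle \<open>x y a\<close>; if \<open>x\<close> sees both pentagon
    neighbours of \<open>a\<close>, the two agree on the pentagon and only \<open>y\<close> can tell
    them apart.\<close>
  have local_clauses:
    "(\<not> R x a \<or> \<not> R x b) \<and> (R x a \<or> R x b \<or> R x e \<or> (R x y \<and> R y a)) \<and>
      (\<not> R x y \<or> \<not> R x a \<or> \<not> R y a) \<and> (R x b \<and> R x e \<longrightarrow> R x y \<noteq> R y a)"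
    if C5: "R a b" "R b c" "R c d" "R d e" "R e a" and V: "V = {a, b, c, d, e, x, y}"
      and new: "x \<notin> {a, b, c, d, e}" for a b c d e x y
  proof -
    have nonadj: "\<not> R a a" "\<not> R a c" "\<not> R a d" "\<not> R x x" using tri C5 R(1,2) by meson+
    have x_tri: "\<not> R x a \<or> \<not> R x b" "\<not> R x b \<or> \<not> R x c" "\<not> R x d \<or> \<not> R x e"
      using tri C5 R(1) by meson+
    have xa: "x \<noteq> a" "x \<in> V" "a \<in> V" using V new by auto
    have "R x a \<or> R x b \<or> R x e \<or> (R x y \<and> R y a)"
      using com[OF xa(2,3)] xa(1) nonadj R(1)[of a x] R(1)[of a y] unfolding V by auto
    moreover have "\<not> R x y \<or> \<not> R x a \<or> \<not> R y a" using tri R(1) by meson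
    moreover have "R x y \<noteq> R y a" if "R x b" "R x e"
    proof -
      have "\<not> R x a" "\<not> R x c" "\<not> R x d" using that x_tri by auto
      moreover have "R a e" "R a x = R x a" "R a y = R y a" using C5 R(1) by auto
      ultimately show ?thesis
        using twin[OF xa(2,3)] xa(1) nonadj C5(1) that unfolding V by auto
    qed
    ultimately show ?thesis using x_tri by blast
  qed
  \<comment> \<open>Allowing \<open>x = y\<close> treats both orders at once.\<close>
  have key: False
    if C5: "R a b" "R b c" "R c d" "R d e" "R e a" and V: "V = {a, b, c, d, e, x, y}"
      and new: "x \<notin> {a, b, c, d, e}" "y \<notin> {a, b, c, d, e}" for a b c d e x y
  proof -
    \<comment> \<open>A common neighbour of \<open>x\<close> and \<open>y\<close> can only lie on
      the pentagon.\<close>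
    have xy: "x = y \<or> R x y \<or> (R x a \<and> R y a) \<or> (R x b \<and> R y b) \<or> (R x c \<and> R y c) \<or>
        (R x d \<and> R y d) \<or> (R x e \<and> R y e)"
      using com[of x y] R(2)[of x] R(2)[of y] unfolding V by auto
    have V': "V = {b, c, d, e, a, x, y}" "V = {c, d, e, a, b, x, y}" "V = {d, e, a, b, c, x, y}"
        "V = {e, a, b, c, d, x, y}" using V by auto
    have V'': "V = {a, b, c, d, e, y, x}" "V = {b, c, d, e, a, y, x}" "V = {c, d, e, a, b, y, x}"
        "V = {d, e, a, b, c, y, x}" "V = {e, a, b, c, d, y, x}" using V by auto
    have new': "x \<notin> {b, c, d, e, a}" "x \<notin> {c, d, e, a, b}" "x \<notin> {d, e, a, b, c}" "x \<notin> {e, a, b, c, d}"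
        "y \<notin> {b, c, d, e, a}" "y \<notin> {c, d, e, a, b}" "y \<notin> {d, e, a, b, c}" "y \<notin> {e, a, b, c, d}"
      using new by auto
    \<comment> \<open>The five rotations of the pentagon, first for \<open>x\<close>, then with
      \<open>x\<close> and \<open>y\<close> exchanged.\<close>
    note cl = local_clauses[OF C5 V new(1)] local_clauses[OF C5(2,3,4,5,1) V'(1) new'(1)]
      local_clauses[OF C5(3,4,5,1,2) V'(2) new'(2)] local_clauses[OF C5(4,5,1,2,3) V'(3) new'(3)]
      local_clauses[OF C5(5,1,2,3,4) V'(4) new'(4)]
    note cl' = local_clauses[OF C5 V''(1) new(2)] local_clauses[OF C5(2,3,4,5,1) V''(2) new'(5)]
      local_clauses[OF C5(3,4,5,1,2) V''(3) new'(6)] local_clauses[OF C5(4,5,1,2,3) V''(4) new'(7)]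
      local_clauses[OF C5(5,1,2,3,4) V''(5) new'(8)]
    show False
    proof (cases "x = y")
      case True
      \<comment> \<open>A sole extra vertex with two neighbours on the pentagon closes a triangle or
        is a twin; with at most one neighbour there it misses some pentagon vertex.\<close>
      have "\<not> R x y" using True R(2) by simp
      then show False using cl unfolding True by argo
    next
      case False
      show False using cl cl' xy False R(1)[of y x] by argo
    qed
  qed
  have "card V \<noteq> 6 \<and> card V \<noteq> 7"
  proof (rule ccontr)
    assume "\<not> (card V \<noteq> 6 \<and> card V \<noteq> 7)"
    then have card: "card V = 6 \<or> card V = 7" by blast
    then have "card V \<ge> 3" by auto
    from pentagon_exists[OF assms this] obtain a b c d e where
      E: "{a, b} \<in> E" "{b, c} \<in> E" "{c, d} \<in> E" "{d, e} \<in> E" "{e, a} \<in> E"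
      and dist: "distinct [a, b, c, d, e]" .
    have C5: "R a b" "R b c" "R c d" "R d e" "R e a" using E by (simp_all add: R_def)
    let ?C = "{a, b, c, d, e}" and ?W = "V - {a, b, c, d, e}"
    have sub: "?C \<subseteq> V" using C5 R(3,4) by blast
    have "card ?C = 5" using dist by simp
    then have "card ?W = 1 \<or> card ?W = 2" using card sub fin by (auto simp: card_Diff_subset)
    then obtain x y where "?W = {x, y}" by (metis card_1_singletonE card_2_iff insert_absorb2)
    then show False using key[OF C5, of x y] sub by blast
  qed
  then show "card V \<noteq> 6" "card V \<noteq> 7" by auto
qed

subsection \<open>Constructions\<close>

definition edges_of :: "('a \<Rightarrow> 'a \<Rightarrow> bool) \<Rightarrow> 'a set set" where
  "edges_of R = {{u, v} |u v. R u v}"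

definition graph_rel :: "'a set \<Rightarrow> ('a \<Rightarrow> 'a \<Rightarrow> bool) \<Rightarrow> bool" where
  "graph_rel V R \<longleftrightarrow> finite V \<and> (\<forall>u v. R u v \<longrightarrow> R v u \<and> u \<in> V \<and> u \<noteq> v)"

lemma graph_relD:
  assumes "graph_rel V R"
  shows "R u v \<Longrightarrow> R v u" "R u v \<Longrightarrow> u \<in> V" "R u v \<Longrightarrow> v \<in> V" "\<not> R u u"
  using assms unfolding graph_rel_def by blast+

lemma edges_of_iff:
  assumes "graph_rel V R"
  shows "{u, v} \<in> edges_of R \<longleftrightarrow> R u v"
  using graph_relD(1)[OF assms] unfolding edges_of_def by (auto simp: doubleton_eq_iff)

lemma simple_graph_edges_of: "graph_rel V R \<Longrightarrow> simple_graph V (edges_of R)"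
  unfolding simple_graph_def graph_rel_def edges_of_def by (auto simp: card_insert_if)

text \<open>Bounding \<open>w\<close> by \<open>V\<close> makes this a finite conjunction of finite
  disjunctions for an explicitly listed \<open>V\<close>, which simplification decides.\<close>

definition twin_free_rel :: "'a set \<Rightarrow> ('a \<Rightarrow> 'a \<Rightarrow> bool) \<Rightarrow> bool" where
  "twin_free_rel V R \<longleftrightarrow> (\<forall>x\<in>V. \<forall>y\<in>V. x = y \<or> (\<exists>w\<in>V. R x w \<noteq> R y w))"

lemma twin_free_edges_of:
  assumes "graph_rel V R" "twin_free_rel V R"
  shows "twin_free V (edges_of R)"
  unfolding twin_free_iff[OF simple_graph_edges_of[OF assms(1)]] edges_of_iff[OF assms(1)]
  using assms(2) unfolding twin_free_rel_def by blast

definition realizable :: "nat \<Rightarrow> nat \<Rightarrow> bool" where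
  "realizable r n \<longleftrightarrow> (\<exists>(V :: nat set) E. simple_graph V E \<and> card V = n \<and>
     twin_free V E \<and> complete_saturated r V E)"

lemma realizable_complete:
  assumes "n < r"
  shows "realizable r n"
  using complete_graph_saturated[of "{..<n}" r] assms unfolding realizable_def
  by (metis card_lessThan finite_lessThan)

text \<open>A clique loses at most \<open>x\<close> when restricted to \<open>V\<close>, and each
  \<open>T\<close> witnessing saturation gains \<open>x\<close>, so the relevant clique sizes rise
  by exactly one.\<close>

lemma add_dominating_vertex:
  assumes G: "simple_graph V E" and tw: "twin_free V E" and sat: "complete_saturated (k + 2) V E"
    and x: "x \<notin> V"
  defines "V' \<equiv> insert x V" and "F \<equiv> E \<union> (\<lambda>v. {x, v}) ` V"
  shows "simple_graph V' F" "twin_free V' F" "complete_saturated (k + 3) V' F"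
proof -
  have fin: "finite V" using G by (simp add: simple_graph_def)
  show G': "simple_graph V' F"
    using G x unfolding simple_graph_def V'_def F_def by (auto simp: card_insert_if)
  have F: "{u, v} \<in> F \<longleftrightarrow> {u, v} \<in> E \<or> (u = x \<and> v \<in> V) \<or> (v = x \<and> u \<in> V)" for u v
    unfolding F_def by (auto simp: doubleton_eq_iff)
  have xE: "{x, v} \<notin> E" "{v, x} \<notin> E" for v
    using simple_graph_edge[OF G, of x v] x by (auto simp: insert_commute)
  have loop: "{v, v} \<notin> E" for v using simple_graph_edge(3)[OF G, of v v] by auto
  show "twin_free V' F"
    unfolding twin_free_iff[OF G'] F
  proof (intro ballI impI)
    fix v w assume vw: "v \<in> V'" "w \<in> V'" "v \<noteq> w"
    consider "v = x" "w \<in> V" | "w = x" "v \<in> V" | "v \<in> V" "w \<in> V" using vw V'_def by auto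
    then show "\<exists>y. ({v, y} \<in> E \<or> v = x \<and> y \<in> V \<or> y = x \<and> v \<in> V) \<noteq>
                   ({w, y} \<in> E \<or> w = x \<and> y \<in> V \<or> y = x \<and> w \<in> V)"
    proof cases
      case 1
      \<comment> \<open>\<open>x\<close> is adjacent to \<open>w\<close>, whereas \<open>w\<close>
        is not its own neighbour.\<close>
      then show ?thesis using loop[of w] x by (intro exI[of _ w]) auto
    next
      case 2
      then show ?thesis using loop[of v] x by (intro exI[of _ v]) auto
    next
      case 3
      then obtain y where "({v, y} \<in> E) \<noteq> ({w, y} \<in> E)"
        using tw vw(3) unfolding twin_free_iff[OF G] by blast
      then show ?thesis using 3 x xE by (intro exI[of _ y]) auto
    qed
  qed
  have free: "\<not> clique E S" if "S \<subseteq> V" "card S = k + 2" for S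
    using sat that unfolding complete_saturated_iff[OF G] by blast
  have "\<not> clique F S" if S: "S \<subseteq> V'" "card S = (k + 1) + 2" for S
  proof
    assume cl: "clique F S"
    have "finite S" using S fin unfolding V'_def by (meson finite_insert finite_subset)
    then have "k + 2 \<le> card (S - {x})" using S by (simp add: card_Diff_singleton_if)
    then obtain T where T: "T \<subseteq> S - {x}" "card T = k + 2" by (meson obtain_subset_with_card_n)
    have "clique E T"
      unfolding clique_def using T(1) cliqueD[OF cl] F by blast
    moreover have "T \<subseteq> V" using T S V'_def by auto
    ultimately show False using free T(2) by blast
  qed
  moreover have "\<exists>T\<subseteq>V' - {v, w}. card T = k + 1 \<and> clique F (insert v T) \<and> clique F (insert w T)"
    if vw: "v \<in> V'" "w \<in> V'" "v \<noteq> w \<and> {v, w} \<notin> F" for v w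
  proof -
    \<comment> \<open>\<open>x\<close> is adjacent to all of \<open>V\<close>, so a non-edge of
      \<open>F\<close> has both ends in \<open>V\<close>.\<close>
    have vwV: "v \<in> V" "w \<in> V" "{v, w} \<notin> E" using vw F unfolding V'_def by auto
    then obtain T where T: "T \<subseteq> V - {v, w}" "card T = k" "clique E (insert v T)" "clique E (insert w T)"
      using sat vw(3) unfolding complete_saturated_iff[OF G] by blast
    have "finite T" "x \<notin> T" using T(1) fin x by (auto intro: finite_subset)
    then have "card (insert x T) = k + 1" using T(2) by simp
    moreover have "clique F (insert y (insert x T))" if y: "y \<in> V" "clique E (insert y T)" for y
      unfolding clique_def F using y cliqueD[OF y(2)] T(1) by blast
    moreover have "insert x T \<subseteq> V' - {v, w}" using T(1) vwV x V'_def by auto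
    ultimately show ?thesis using T(3,4) vwV by (intro exI[of _ "insert x T"]) simp
  qed
  ultimately have "complete_saturated ((k + 1) + 2) V' F"
    unfolding complete_saturated_iff[OF G'] by simp
  then show "complete_saturated (k + 3) V' F" by (simp add: numeral_3_eq_3)
qed

lemma realizable_Suc:
  assumes "realizable r n" "r \<ge> 2"
  shows "realizable (Suc r) (Suc n)"
proof -
  obtain V :: "nat set" and E where VE: "simple_graph V E" "card V = n" "twin_free V E"
    "complete_saturated r V E"
    using assms unfolding realizable_def by blast
  obtain k where k: "r = k + 2" using assms(2) by (metis add.commute le_Suc_ex)
  have fin: "finite V" using VE(1) by (simp add: simple_graph_def)
  then obtain x where x: "x \<notin> V" using ex_new_if_finite infinite_UNIV_nat by blast
  have "card (insert x V) = Suc n" using x fin VE(2) by simp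
  moreover have "Suc r = k + 3" using k by simp
  ultimately show ?thesis
    using add_dominating_vertex[OF VE(1,3) VE(4)[unfolded k] x] unfolding realizable_def by metis
qed

section \<open>Extending triangle-free graphs by three vertices\<close>

text \<open>
  The sets \<open>A\<close> and \<open>B\<close> are maximal among the independent sets avoiding \<open>z\<close>. The three vertices
  \<open>a\<close>, \<open>b\<close>, \<open>c\<close> added to such a graph are joined to \<open>B \<union> {c}\<close>, \<open>A \<union> {c}\<close> and \<open>{z, a, b}\<close>;
  the conditions involving \<open>z\<close>, \<open>A\<close> and \<open>B\<close> are what this needs, and they are inherited by
  \<open>z\<close>, \<open>A \<union> {a}\<close>, \<open>B \<union> {b}\<close>.
\<close>

locale extendable =
  fixes V :: "'a set" and R :: "'a \<Rightarrow> 'a \<Rightarrow> bool" and z :: 'a and A B :: "'a set"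
  assumes twin: "twin_free_rel V R"
    and tri: "\<forall>x\<in>V. \<forall>y\<in>V. \<forall>w\<in>V. R x y \<and> R y w \<longrightarrow> \<not> R x w"
    and com: "\<forall>x\<in>V. \<forall>y\<in>V. x = y \<or> R x y \<or> (\<exists>w\<in>V. R x w \<and> R y w)"
    and z: "z \<in> V" "z \<notin> A" "z \<notin> B"
    and sub: "A \<subseteq> V" "B \<subseteq> V" "A \<inter> B = {}" "A \<noteq> {}" "B \<noteq> {}"
    and indep: "\<forall>x\<in>A. \<forall>y\<in>A. \<not> R x y" "\<forall>x\<in>B. \<forall>y\<in>B. \<not> R x y"
    and domA: "\<forall>x\<in>V. x = z \<or> x \<in> A \<or> (\<exists>y\<in>A. R x y)"
    and domB: "\<forall>x\<in>V. x = z \<or> x \<in> B \<or> (\<exists>y\<in>B. R x y)"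
    and domz: "\<forall>x\<in>V. x = z \<or> x \<in> A \<or> x \<in> B \<or> R x z"
    and nbz: "\<exists>x\<in>V. R z x \<noteq> (x \<in> A)" "\<exists>x\<in>V. R z x \<noteq> (x \<in> B)"

lemma extendable_saturated:
  assumes R: "graph_rel V R" and "extendable V R z A B"
  shows "complete_saturated 3 V (edges_of R)"
proof -
  have "\<forall>a b c. R a b \<and> R b c \<longrightarrow> \<not> R a c"
    using extendable.tri[OF assms(2)] graph_relD(2,3)[OF R] by meson
  moreover have "\<forall>v\<in>V. \<forall>w\<in>V. v \<noteq> w \<and> \<not> R v w \<longrightarrow> (\<exists>x. R v x \<and> R w x)"
    using extendable.com[OF assms(2)] by meson
  ultimately show ?thesis
    unfolding saturated_3_iff[OF simple_graph_edges_of[OF R]] edges_of_iff[OF R] by blast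
qed

text \<open>\<open>P\<close> lists each new edge in one direction. The new vertices have independent
  neighbourhoods, so no triangle arises; \<open>domB\<close>, \<open>domA\<close> and
  \<open>domz\<close> supply common neighbours of old vertices with \<open>a\<close>,
  \<open>b\<close> and \<open>c\<close>, while \<open>z\<close> shares \<open>c\<close> with
  \<open>a\<close> and \<open>b\<close>.\<close>

lemma extendable_step:
  assumes R: "graph_rel V R" and ext: "extendable V R z A B"
    and new: "a \<notin> V" "b \<notin> V" "c \<notin> V" "distinct [a, b, c]"
  defines "P \<equiv> \<lambda>u v. (u = a \<and> v \<in> insert c B) \<or> (u = b \<and> v \<in> insert c A) \<or> (u = c \<and> v = z)"
  defines "R' \<equiv> \<lambda>u v. R u v \<or> P u v \<or> P v u" and "V' \<equiv> V \<union> {a, b, c}"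
  shows "graph_rel V' R'" "extendable V' R' z (insert a A) (insert b B)"
proof -
  note RD = graph_relD[OF R]
  interpret extendable V R z A B by fact
  have R'_old: "R' u v = R u v" if "u \<in> V" "v \<in> V" for u v
    using that new unfolding R'_def P_def by auto
  have R'_a: "R' a v \<longleftrightarrow> v = c \<or> v \<in> B" "R' v a \<longleftrightarrow> v = c \<or> v \<in> B" for v
    using new z sub RD(2,3)[of a v] RD(2,3)[of v a] unfolding R'_def P_def by auto
  have R'_b: "R' b v \<longleftrightarrow> v = c \<or> v \<in> A" "R' v b \<longleftrightarrow> v = c \<or> v \<in> A" for v
    using new z sub RD(2,3)[of b v] RD(2,3)[of v b] unfolding R'_def P_def by auto
  have R'_c: "R' c v \<longleftrightarrow> v = z \<or> v = a \<or> v = b" "R' v c \<longleftrightarrow> v = z \<or> v = a \<or> v = b" for v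
    using new z sub RD(2,3)[of c v] RD(2,3)[of v c] unfolding R'_def P_def by auto
  note R' = R'_a R'_b R'_c
  have V': "V' = insert a (insert b (insert c V))" unfolding V'_def by auto
  have fin: "finite V" using R unfolding graph_rel_def by blast
  have inV: "v \<in> V \<Longrightarrow> v \<noteq> a \<and> v \<noteq> b \<and> v \<noteq> c" for v using new by auto
  have memV: "v \<in> A \<Longrightarrow> v \<in> V" "v \<in> B \<Longrightarrow> v \<in> V" for v using sub by auto
  have sym: "R' u v \<Longrightarrow> R' v u" for u v unfolding R'_def using RD(1) by blast
  show rel': "graph_rel V' R'"
    unfolding graph_rel_def
  proof (intro conjI allI impI)
    show "finite V'" using fin V' by simp
    fix u v assume uv: "R' u v"
    show "R' v u" using sym uv .
    show "u \<in> V'" "u \<noteq> v"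
      using uv RD(2,4) z sub new unfolding R'_def P_def V' by auto
  qed
  have twin': "twin_free_rel V' R'"
    unfolding twin_free_rel_def
  proof (intro ballI)
    have oldold: "\<exists>w\<in>V'. R' x w \<noteq> R' y w" if "x \<in> V" "y \<in> V" "x \<noteq> y" for x y
      using twin that unfolding twin_free_rel_def using R'_old unfolding V' by (metis insertCI)
    \<comment> \<open>Among old vertices only \<open>z\<close> is adjacent to \<open>c\<close>, so
      \<open>c\<close> separates \<open>a\<close> from all others; \<open>nbz\<close> handles
      \<open>z\<close>.\<close>
    have aold: "\<exists>w\<in>V'. R' a w \<noteq> R' y w" if y: "y \<in> V" for y
    proof (cases "y = z")
      case True
      then show ?thesis using nbz(2) R'_old[OF z(1)] R'_a(1) inV unfolding V' by (metis insertCI)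
    next
      case False
      then show ?thesis using R' inV[OF y] V' by (intro bexI[of _ c]) auto
    qed
    have bold: "\<exists>w\<in>V'. R' b w \<noteq> R' y w" if y: "y \<in> V" for y
    proof (cases "y = z")
      case True
      then show ?thesis using nbz(1) R'_old[OF z(1)] R'_b(1) inV unfolding V' by (metis insertCI)
    next
      case False
      then show ?thesis using R' inV[OF y] V' by (intro bexI[of _ c]) auto
    qed
    \<comment> \<open>\<open>c\<close> is adjacent to both \<open>a\<close> and \<open>b\<close>; no
      old vertex is, because \<open>A\<close> and \<open>B\<close> are disjoint.\<close>
    have cold: "\<exists>w\<in>V'. R' c w \<noteq> R' y w" if y: "y \<in> V" for y
    proof (cases "y \<in> A")
      case True
      then have "y \<notin> B" using sub by auto
      then show ?thesis using R' inV[OF y] V' by (intro bexI[of _ a]) auto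
    next
      case False
      then show ?thesis using R' inV[OF y] V' by (intro bexI[of _ b]) auto
    qed
    have ab: "\<exists>w\<in>V'. R' a w \<noteq> R' b w"
    proof -
      obtain w where "w \<in> A" using sub by auto
      then show ?thesis using sub(3) memV inV[of w] R' V' by (intro bexI[of _ w]) auto
    qed
    have ac: "\<exists>w\<in>V'. R' a w \<noteq> R' c w" using R' V' inV[OF z(1)] new(4) memV by (intro bexI[of _ c]) auto
    have bc: "\<exists>w\<in>V'. R' b w \<noteq> R' c w" using R' V' inV[OF z(1)] new(4) memV by (intro bexI[of _ c]) auto
    \<comment> \<open>Symmetry of \<open>D\<close> reduces the sixteen combinations of old and new
      vertices to those just proved.\<close>
    define D where "D x y \<longleftrightarrow> (\<exists>w\<in>V'. R' x w \<noteq> R' y w)" for x y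
    have D_sym: "D x y \<Longrightarrow> D y x" for x y unfolding D_def by metis
    note D = oldold[folded D_def] aold[folded D_def] bold[folded D_def] cold[folded D_def]
      ab[folded D_def] ac[folded D_def] bc[folded D_def]
    fix x y assume "x \<in> V'" "y \<in> V'"
    then have "x = y \<or> D x y"
      unfolding V' by (elim insertE) (use D D_sym in \<open>metis+\<close>)
    then show "x = y \<or> (\<exists>w\<in>V'. R' x w \<noteq> R' y w)" unfolding D_def .
  qed
  have tri_old: "\<not> R' x w" if "R' x y" "R' y w" "x \<in> V" "y \<in> V" "w \<in> V" for x y w
    using tri that R'_old by metis
  have irrefl: "\<not> R' v v" for v using graph_relD(4)[OF rel'] .
  have new_ne: "a \<noteq> b" "a \<noteq> c" "b \<noteq> c" "z \<noteq> a" "z \<noteq> b" "z \<noteq> c" using new z(1) by auto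
  have indepA: "\<not> R' u v" if "u \<in> A" "v \<in> A" for u v using that indep(1) R'_old memV by metis
  have indepB: "\<not> R' u v" if "u \<in> B" "v \<in> B" for u v using that indep(2) R'_old memV by metis
  have c_AB: "\<not> R' c v" "\<not> R' v c" if "v \<in> A \<or> v \<in> B" for v
    using that R'_c memV inV z by metis+
  have tri_a: "\<not> R' y w" if "R' a y" "R' a w" for y w
    using that irrefl indepB c_AB unfolding R'_a by metis
  have tri_b: "\<not> R' y w" if "R' b y" "R' b w" for y w
    using that irrefl indepA c_AB unfolding R'_b by metis
  have "\<not> R' z a" "\<not> R' z b" "\<not> R' a b" using R'_a R'_b new_ne z memV(1) inV by metis+
  then have tri_c: "\<not> R' y w" if "R' c y" "R' c w" for y w
    using that irrefl sym unfolding R'_c by metis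
  \<comment> \<open>A triangle containing a new vertex can be reordered to start there.\<close>
  have tri_new: "\<not> R' y w" if "x \<in> {a, b, c}" "R' x y" "R' x w" for x y w
    using that tri_a tri_b tri_c by blast
  have tri': "\<not> R' x w" if "R' x y" "R' y w" for x y w
  proof (cases "x \<in> V \<and> y \<in> V \<and> w \<in> V")
    case True
    then show ?thesis using tri_old that by blast
  next
    case False
    then have "x \<in> {a, b, c} \<or> y \<in> {a, b, c} \<or> w \<in> {a, b, c}"
      using graph_relD(2,3)[OF rel'] that unfolding V' by blast
    then show ?thesis using tri_new that sym by meson
  qed
  have com': "x = y \<or> R' x y \<or> (\<exists>w\<in>V'. R' x w \<and> R' y w)" if "x \<in> V'" "y \<in> V'" for x y
  proof -
    have oldold: "x = y \<or> R' x y \<or> (\<exists>w\<in>V'. R' x w \<and> R' y w)" if "x \<in> V" "y \<in> V" for x y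
      using com that R'_old unfolding V' by (metis insertCI)
    have aold: "R' a y \<or> (\<exists>w\<in>V'. R' a w \<and> R' y w)" if y: "y \<in> V" for y
      using domB y R' R'_old[OF y] memV unfolding V' by (metis insertCI)
    have bold: "R' b y \<or> (\<exists>w\<in>V'. R' b w \<and> R' y w)" if y: "y \<in> V" for y
      using domA y R' R'_old[OF y] memV unfolding V' by (metis insertCI)
    \<comment> \<open>Vertices of \<open>A\<close> share \<open>b\<close> with \<open>c\<close>,
      those of \<open>B\<close> share \<open>a\<close>, the other old ones share \<open>z\<close>;
      \<open>z\<close> itself is adjacent to \<open>c\<close>.\<close>
    have cold: "R' c y \<or> (\<exists>w\<in>V'. R' c w \<and> R' y w)" if y: "y \<in> V" for y
      using domz y R' R'_old[OF y] z(1) unfolding V' by (metis insertCI)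
    have ab: "\<exists>w\<in>V'. R' a w \<and> R' b w" using R' V' by (intro bexI[of _ c]) auto
    have ac: "R' a c" "R' b c" using R' by auto
    define Q where "Q x y \<longleftrightarrow> R' x y \<or> (\<exists>w\<in>V'. R' x w \<and> R' y w)" for x y
    have Q_sym: "Q x y \<Longrightarrow> Q y x" for x y unfolding Q_def using sym by metis
    have Q: "x = y \<or> Q x y" if "x \<in> V" "y \<in> V" for x y using oldold[OF that] unfolding Q_def .
    note Q = this aold[folded Q_def] bold[folded Q_def] cold[folded Q_def]
    have Q': "Q a b" "Q a c" "Q b c" using ab ac unfolding Q_def by blast+
    have "x = y \<or> Q x y"
      using that unfolding V' by (elim insertE) (use Q Q' Q_sym in \<open>metis+\<close>)
    then show ?thesis unfolding Q_def .
  qed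
  have aA: "\<not> R' a v" if "v \<in> A" for v using that R'_a memV inV sub(3) by (metis disjoint_iff)
  have bB: "\<not> R' b v" if "v \<in> B" for v using that R'_b memV inV sub(3) by (metis disjoint_iff)
  have indepA': "\<forall>x\<in>insert a A. \<forall>y\<in>insert a A. \<not> R' x y"
    using indepA irrefl aA new_ne sym by (metis insertE)
  have indepB': "\<forall>x\<in>insert b B. \<forall>y\<in>insert b B. \<not> R' x y"
    using indepB irrefl bB new_ne sym by (metis insertE)
  \<comment> \<open>\<open>b\<close> sees the nonempty set \<open>A\<close>, and \<open>c\<close>
    sees \<open>a\<close>; \<open>domB'\<close> is analogous.\<close>
  have domA': "\<forall>x\<in>V'. x = z \<or> x \<in> insert a A \<or> (\<exists>y\<in>insert a A. R' x y)"
    using domA R' R'_old memV sub(4) unfolding V' by (metis insertCI insertE ex_in_conv)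
  have domB': "\<forall>x\<in>V'. x = z \<or> x \<in> insert b B \<or> (\<exists>y\<in>insert b B. R' x y)"
    using domB R' R'_old memV sub(5) unfolding V' by (metis insertCI insertE ex_in_conv)
  have domz': "\<forall>x\<in>V'. x = z \<or> x \<in> insert a A \<or> x \<in> insert b B \<or> R' x z"
    using domz R' R'_old[OF _ z(1)] unfolding V' by auto
  \<comment> \<open>The new neighbour \<open>c\<close> of \<open>z\<close> lies in neither enlarged
    set, which restores both parts of \<open>nbz\<close>.\<close>
  have "R' z c" "c \<in> V'" "c \<notin> insert a A" "c \<notin> insert b B"
    using R'_c(2)[of z] new_ne new(3) memV[of c] V' by auto
  then have nbz': "\<exists>x\<in>V'. R' z x \<noteq> (x \<in> insert a A)" "\<exists>x\<in>V'. R' z x \<noteq> (x \<in> insert b B)"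
    by metis+
  have sub': "z \<in> V'" "z \<notin> insert a A" "z \<notin> insert b B" "insert a A \<subseteq> V'" "insert b B \<subseteq> V'"
      "insert a A \<inter> insert b B = {}"
    using z sub new memV unfolding V' by auto
  have tri'': "\<forall>x\<in>V'. \<forall>y\<in>V'. \<forall>w\<in>V'. R' x y \<and> R' y w \<longrightarrow> \<not> R' x w"
    by (intro ballI impI, elim conjE, erule (1) tri')
  have com'': "\<forall>x\<in>V'. \<forall>y\<in>V'. x = y \<or> R' x y \<or> (\<exists>w\<in>V'. R' x w \<and> R' y w)"
    by (intro ballI com')
  show "extendable V' R' z (insert a A) (insert b B)"
    by (rule extendable.intro[OF twin' tri'' com'' sub' insert_not_empty insert_not_empty
      indepA' indepB' domA' domB' domz' nbz'])
qed

section \<open>Starting graphs and all orders for \<open>r = 3\<close>\<close>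

definition adj :: "('a \<times> 'a) list \<Rightarrow> 'a \<Rightarrow> 'a \<Rightarrow> bool" where
  "adj es u v \<longleftrightarrow> (u, v) \<in> set es \<or> (v, u) \<in> set es"

lemma graph_rel_adj:
  assumes "finite V" "\<forall>(u, v)\<in>set es. u \<in> V \<and> v \<in> V \<and> u \<noteq> v"
  shows "graph_rel V (adj es)"
  using assms unfolding graph_rel_def adj_def by auto

definition pentagon :: "(nat \<times> nat) list" where
  "pentagon = [(0,1), (1,2), (2,3), (3,4), (4,0)]"

text \<open>Found by computer search.\<close>

definition graph9 :: "(nat \<times> nat) list" where
  "graph9 = [(0,1), (0,3), (0,4), (0,6), (1,2), (1,5), (2,3), (2,7), (3,8), (4,7), (4,8),
     (5,6), (5,8), (6,7)]"

text \<open>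
  A crown graph on 1, 2, 3 and 4, 5, 6, whose missing perfect matching is replaced by paths
  through 7, 8, 9; these are joined to 0.
\<close>

definition graph10 :: "(nat \<times> nat) list" where
  "graph10 = [(0,7), (0,8), (0,9), (1,5), (1,6), (2,4), (2,6), (3,4), (3,5),
     (7,1), (7,4), (8,2), (8,5), (9,3), (9,6)]"


lemma lessThan_5: "{..<5::nat} = {0, 1, 2, 3, 4}"
  by auto

lemma lessThan_7: "{..<7::nat} = {0, 1, 2, 3, 4, 5, 6}"
  by auto

lemma lessThan_8: "{..<8::nat} = {0, 1, 2, 3, 4, 5, 6, 7}"
  by auto

lemma lessThan_9: "{..<9::nat} = {0, 1, 2, 3, 4, 5, 6, 7, 8}"
  by auto

lemma lessThan_10: "{..<10::nat} = {0, 1, 2, 3, 4, 5, 6, 7, 8, 9}"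
  by auto

text \<open>Without 0 the pentagon is the path 1, 2, 3, 4, whose colour classes serve as
  \<open>A\<close> and \<open>B\<close>.\<close>

lemma extendable_pentagon:
  "graph_rel {..<5} (adj pentagon)" "extendable {..<5} (adj pentagon) 0 {1, 3} {2, 4}"
proof -
  show "graph_rel {..<5} (adj pentagon)" by (rule graph_rel_adj) (simp_all add: pentagon_def)
  show "extendable {..<5} (adj pentagon) 0 {1, 3} {2, 4}"
    unfolding extendable_def twin_free_rel_def lessThan_5
    by (intro conjI; simp add: adj_def pentagon_def)
qed

lemma extendable_graph9:
  "graph_rel {..<9} (adj graph9)" "extendable {..<9} (adj graph9) 0 {1, 7, 8} {2, 4, 5}"
proof -
  show "graph_rel {..<9} (adj graph9)" by (rule graph_rel_adj) (simp_all add: graph9_def)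
  show "extendable {..<9} (adj graph9) 0 {1, 7, 8} {2, 4, 5}"
    unfolding extendable_def twin_free_rel_def lessThan_9
    by (intro conjI; simp add: adj_def graph9_def)
qed

text \<open>\<open>A\<close> and \<open>B\<close> are the two sides of the crown graph; the
  remaining vertices 7, 8, 9 are the neighbours of 0.\<close>

lemma extendable_graph10:
  "graph_rel {..<10} (adj graph10)" "extendable {..<10} (adj graph10) 0 {1, 2, 3} {4, 5, 6}"
proof -
  show "graph_rel {..<10} (adj graph10)" by (rule graph_rel_adj) (simp_all add: graph10_def)
  show "extendable {..<10} (adj graph10) 0 {1, 2, 3} {4, 5, 6}"
    unfolding extendable_def twin_free_rel_def lessThan_10
    by (intro conjI; simp add: adj_def graph10_def)
qed

lemma realizable_extendable:
  assumes "graph_rel V R" "extendable (V :: nat set) R z A B" "card V = n"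
  shows "realizable 3 n"
  unfolding realizable_def
  using simple_graph_edges_of[OF assms(1)] assms(3) extendable_saturated[OF assms(1,2)]
    twin_free_edges_of[OF assms(1) extendable.twin[OF assms(2)]] by blast

lemma extendable_add_3:
  assumes "graph_rel V R" "extendable (V :: nat set) R z A B"
  obtains V' R' A' B' where "graph_rel V' R'" "extendable (V' :: nat set) R' z A' B'" "card V' = card V + 3"
proof -
  have fin: "finite V" using assms(1) unfolding graph_rel_def by blast
  then obtain m where m: "\<And>v. v \<in> V \<Longrightarrow> v < m" by (metis finite_nat_set_iff_bounded)
  have new: "m \<notin> V" "m + 1 \<notin> V" "m + 2 \<notin> V" "distinct [m, m + 1, m + 2]"
    using m[of m] m[of "m + 1"] m[of "m + 2"] by auto
  have "card (V \<union> {m, m + 1, m + 2}) = card V + 3"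
    using fin new by (subst card_Un_disjoint) auto
  then show thesis using that extendable_step[OF assms new] by blast
qed

lemma extendable_add_multiple_3:
  assumes "graph_rel V R" "extendable (V :: nat set) R z A B"
  shows "realizable 3 (card V + 3 * k)"
  using assms
\<comment> \<open>The extension keeps \<open>z\<close> and changes all other data.\<close>
proof (induction k arbitrary: V R A B)
  case 0
  then show ?case using realizable_extendable by simp
next
  case (Suc k)
  obtain V' R' A' B' where "graph_rel V' R'" "extendable V' R' z A' B'" "card V' = card V + 3"
    using extendable_add_3[OF Suc.prems] .
  then show ?case using Suc.IH[of V' R' A' B'] by (simp add: algebra_simps)
qed

lemma realizable_3:
  assumes "n = 5 \<or> n \<ge> 8"
  shows "realizable 3 n"
proof -
  \<comment> \<open>5, 9 and 10 represent the three residues modulo 3; each residue class is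
    complete from 8 on.\<close>
  have "\<exists>k. n = 5 + 3 * k \<or> n = 9 + 3 * k \<or> n = 10 + 3 * k" using assms by presburger
  then show ?thesis
    using extendable_add_multiple_3[OF extendable_pentagon] extendable_add_multiple_3[OF extendable_graph9]
      extendable_add_multiple_3[OF extendable_graph10] by auto
qed

section \<open>The two special orders for \<open>r = 4\<close>, and all larger
  \<open>r\<close>\<close>

lemma realizable_4_of_rel:
  fixes V :: "nat set"
  assumes R: "graph_rel V R" and tw: "twin_free_rel V R"
    and free: "\<forall>a\<in>V. \<forall>b\<in>V. R a b \<longrightarrow> (\<forall>c\<in>V. R a c \<and> R b c \<longrightarrow>
      (\<forall>d\<in>V. \<not> (R a d \<and> R b d \<and> R c d)))"
    and com: "\<forall>v\<in>V. \<forall>w\<in>V. v = w \<or> R v w \<or>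
      (\<exists>x\<in>V. R v x \<and> R w x \<and> (\<exists>y\<in>V. R v y \<and> R w y \<and> R x y))"
  shows "realizable 4 (card V)"
proof -
  note G = simple_graph_edges_of[OF R] and E = edges_of_iff[OF R] and RD = graph_relD[OF R]
  have "\<not> clique (edges_of R) S" if S: "S \<subseteq> V" "card S = 2 + 2" for S
  proof
    assume cl: "clique (edges_of R) S"
    have "card S = 4" using S(2) by simp
    then obtain a T where S': "S = insert a T" "a \<notin> T" "card T = 3"
      by (metis card_eq_SucD eval_nat_numeral(2) semiring_norm(26,27,28) numeral_3_eq_3)
    then obtain b c d where T: "T = {b, c, d}" "b \<noteq> c" "c \<noteq> d" "b \<noteq> d"
      unfolding card_3_iff by blast
    have "R a b" "R a c" "R a d" "R b c" "R b d" "R c d"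
      using cl S' T unfolding clique_def E by auto
    then show False using free RD(2,3) by meson
  qed
  moreover have "\<exists>T\<subseteq>V - {v, w}. card T = 2 \<and> clique (edges_of R) (insert v T) \<and>
      clique (edges_of R) (insert w T)"
    if vw: "v \<in> V" "w \<in> V" "v \<noteq> w \<and> \<not> R v w" for v w
  proof -
    \<comment> \<open>The adjacent common neighbours \<open>x\<close>, \<open>y\<close> form the
      clique \<open>T\<close> of size \<open>k = 2\<close>.\<close>
    obtain x y where xy: "R v x" "R w x" "R v y" "R w y" "R x y" using com vw by metis
    then have "{x, y} \<subseteq> V - {v, w}" "card {x, y} = 2" using RD(3,4) by (auto simp: card_insert_if)
    moreover have "clique (edges_of R) (insert v {x, y})" "clique (edges_of R) (insert w {x, y})"
      using xy RD(1) unfolding clique_def E by auto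
    ultimately show ?thesis by blast
  qed
  ultimately have "complete_saturated (2 + 2) V (edges_of R)"
    unfolding complete_saturated_iff[OF G] E by simp
  then show ?thesis
    unfolding realizable_def using G twin_free_edges_of[OF R tw] by auto
qed

text \<open>The complement of a 7-cycle.\<close>

definition k4_graph7 :: "(nat \<times> nat) list" where
  "k4_graph7 = [(0,2), (0,3), (0,4), (0,5), (1,3), (1,4), (1,5), (1,6),
     (2,4), (2,5), (2,6), (3,5), (3,6), (4,6)]"

text \<open>A 7-cycle has no four pairwise non-adjacent vertices. In its complement the non-edges
  join \<open>i\<close> and \<open>i + 1\<close> modulo 7, and \<open>i + 3\<close>,
  \<open>i + 5\<close> are adjacent common neighbours.\<close>

lemma realizable_4_7: "realizable 4 7"
proof -
  have "realizable 4 (card {..<7::nat})"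
  proof (rule realizable_4_of_rel)
    show "graph_rel {..<7} (adj k4_graph7)" by (rule graph_rel_adj) (simp_all add: k4_graph7_def)
  qed (unfold twin_free_rel_def lessThan_7, simp_all add: adj_def k4_graph7_def)
  then show ?thesis by simp
qed

text \<open>Found by computer search.\<close>

definition k4_graph8 :: "(nat \<times> nat) list" where
  "k4_graph8 = [(0,2), (0,4), (0,6), (0,7), (1,2), (1,3), (1,5), (1,6),
     (2,5), (2,6), (2,7), (3,4), (3,5), (3,6), (4,5), (4,6), (4,7), (5,7)]"

lemma realizable_4_8: "realizable 4 8"
proof -
  have "realizable 4 (card {..<8::nat})"
  proof (rule realizable_4_of_rel)
    show "graph_rel {..<8} (adj k4_graph8)" by (rule graph_rel_adj) (simp_all add: k4_graph8_def)
  qed (unfold twin_free_rel_def lessThan_8, simp_all add: adj_def k4_graph8_def)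
  then show ?thesis by simp
qed

text \<open>For \<open>r = 4\<close>, dominating vertices over the case \<open>r = 3\<close> give
  \<open>n = 6\<close> and \<open>n \<ge> 9\<close>; the gaps 7 and 8 come from the impossible
  orders 6 and 7 and need their own graphs. Larger \<open>r\<close> inherit from
  \<open>r = 4\<close>.\<close>

lemma realizable_ge_4:
  assumes "r \<ge> 4" "n \<ge> r + 2"
  shows "realizable r n"
  using assms
proof (induction r arbitrary: n rule: nat_induct_at_least)
  case base
  then consider "n = 7" | "n = 8" | m where "n = Suc m" "m = 5 \<or> m \<ge> 8" by (cases n) force+
  then show ?case
  proof cases
    case 3
    then show ?thesis using realizable_Suc[OF realizable_3[OF 3(2)]] by simp
  qed (use realizable_4_7 realizable_4_8 in auto)
next
  case (Suc r)
  then obtain m where "n = Suc m" "m \<ge> r + 2" by (cases n) auto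
  then show ?case using realizable_Suc Suc.IH Suc.hyps by simp
qed

theorem theorem1:
  fixes r n :: nat
  assumes "r \<ge> 3"
  shows "(\<exists>(V :: nat set) E. simple_graph V E \<and> card V = n \<and>
            twin_free V E \<and> complete_saturated r V E) \<longleftrightarrow>
         \<not> (n = r \<or> n = r + 1 \<or> (r = 3 \<and> n = 6) \<or> (r = 3 \<and> n = 7))"
proof -
  define k where "k = r - 2"
  then have k: "r = k + 2" using assms by simp
  have "\<not> (n = r \<or> n = r + 1 \<or> (r = 3 \<and> n = 6) \<or> (r = 3 \<and> n = 7))" if real: "realizable r n"
  proof -
    obtain V :: "nat set" and E where G: "simple_graph V E" "twin_free V E" "complete_saturated r V E"
      and n: "card V = n"
      using real unfolding realizable_def by blast
    have "card V \<noteq> 6 \<and> card V \<noteq> 7" if "r = 3"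
      using no_twin_free_saturated_3[OF G(1,2)] G(3) that by blast
    then show ?thesis
      using no_twin_free_saturated_r[OF G(1,2) G(3)[unfolded k]]
        no_twin_free_saturated_Suc_r[OF G(1,2) G(3)[unfolded k]] k n by auto
  qed
  moreover have "realizable r n"
    if cond: "\<not> (n = r \<or> n = r + 1 \<or> (r = 3 \<and> n = 6) \<or> (r = 3 \<and> n = 7))"
  proof -
    \<comment> \<open>For \<open>r = 3\<close> the excluded orders are 3, 4, 6 and 7, so
      \<open>n \<ge> 3\<close> leaves 5 and everything from 8 on.\<close>
    consider "n < r" | "r = 3" "n = 5 \<or> n \<ge> 8" | "r \<ge> 4" "n \<ge> r + 2"
      using cond assms by linarith
    then show ?thesis using realizable_complete realizable_3 realizable_ge_4 by cases auto
  qed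
  ultimately show ?thesis unfolding realizable_def[symmetric] by blast
qed

end
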